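(* For each scientific record $\mathbf{x}$ with conjugate $\mathbf{y}_{\mathbf{x}}$ we have $$\mathrm{Su}^{+}_{2}(\mathbf{x})=\mathrm{H}^l_2(\mathbf{x})=\mathrm{Su}_{+}^{2}(\mathbf{y}_{\mathbf{x}})\qquad\text{and}\qquad \mathrm{Su}_{+}^{2}(\mathbf{x})=\mathrm{H}^u_2(\mathbf{x})=\mathrm{Su}^{+}_{2}(\mathbf{y}_{\mathbf{x}}).$$
   Context: Notation: $a\wedge b=\min(a,b)$, $a_+=\max(a,0)$, $\mathbb{N}=\{1,2,\ldots\}$. A scientific record is a sequence $\mathbf{x}=(x_1,x_2,\ldots)$ with $x_i\in\mathbb{N}\cup\{0\}$, $x_1\ge x_2\ge\ldots$ and $x_1\ge1$. Its conjugate is $\mathbf{y}_{\mathbf{x}}=(y_1,y_2,\ldots)$ with $y_i$ the number of $k\in\mathbb{N}$ such that $x_k\ge i$. Sequences are identified with functions $\mathbb{N}\to[0,\infty]$. The $h$-index is $\mathrm{H}(\mathbf{x})=\max\{k:x_k\ge k\}=\max_k\{k\wedge x_k\}$. The upper $2$-$h$-index and the lower $2$-$h$-index are $$\mathrm{H}^u_2(\mathbf{x})=\max_k\{(k+\mathrm{H}(\mathbf{x}))\wedge x_k\},$$ $$\mathrm{H}^l_2(\mathbf{x})=\mathrm{H}(\mathbf{x})+\max_k\{(k-\mathrm{H}(\mathbf{x}))_+\wedge x_k\}=\max_k\{k\wedge(x_k+\mathrm{H}(\mathbf{x}))\}.$$ Let $\mu$ be the counting measure on $2^{\mathbb{N}}$.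 For a sequence $\mathbf{z}=(z_1,z_2,\ldots)$ in $[0,\infty]$ let $\mathrm{Su}(\mathbf{z})=\sup_{t\in[0,\infty]}\{t\wedge\mu(\{i:z_i\ge t\})\}$. The upper and lower $2$-Sugeno integrals with respect to $+$ are $$\mathrm{Su}^{+}_{2}(\mathbf{z})=\sup_{t\in[0,\infty]}\big\{(t+\mathrm{Su}(\mathbf{z}))\wedge\mu(\{i:z_i\ge t\})\big\},\qquad \mathrm{Su}_{+}^{2}(\mathbf{z})=\sup_{t\in[0,\infty]}\big\{t\wedge\big(\mu(\{i:z_i\ge t\})+\mathrm{Su}(\mathbf{z})\big)\big\}.$$ *)

theory Defs
  imports "HOL-Analysis.Analysis"
begin

text \<open>
  Sequences are indexed by the positive integers: a sequence is a function on \<^typ>\<open>nat\<close> that is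
  only ever inspected on \<^term>\<open>{1..} :: nat set\<close>, its value at \<open>0\<close> being irrelevant. The interval
  \<open>[0,\<infinity>]\<close> is the type \<^typ>\<open>ennreal\<close>.
\<close>

definition scientific_record :: "(nat \<Rightarrow> nat) \<Rightarrow> bool" where
  "scientific_record x \<longleftrightarrow> antimono_on {1..} x \<and> 1 \<le> x 1"

abbreviation counting :: "nat measure" where
  "counting \<equiv> count_space {1..}"

text \<open>
  A record need not tend to \<open>0\<close>, so infinitely many \<open>k\<close> may satisfy \<open>x k \<ge> i\<close>, in which case
  the conjugate takes the value \<open>\<infinity>\<close> at \<open>i\<close>.
\<close>

definition conjugate :: "(nat \<Rightarrow> nat) \<Rightarrow> nat \<Rightarrow> ennreal" where
  "conjugate x i = emeasure counting {k \<in> {1..}. i \<le> x k}"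

definition h_index :: "(nat \<Rightarrow> nat) \<Rightarrow> nat" where
  "h_index x = Max {k \<in> {1..}. k \<le> x k}"

definition upper_h2_index :: "(nat \<Rightarrow> nat) \<Rightarrow> nat" where
  "upper_h2_index x = Max ((\<lambda>k. min (k + h_index x) (x k)) ` {1..})"

text \<open>Truncated subtraction on \<^typ>\<open>nat\<close> is the positive part \<open>(k - H)\<^sub>+\<close>.\<close>

definition lower_h2_index :: "(nat \<Rightarrow> nat) \<Rightarrow> nat" where
  "lower_h2_index x = h_index x + Max ((\<lambda>k. min (k - h_index x) (x k)) ` {1..})"

definition sugeno :: "(nat \<Rightarrow> ennreal) \<Rightarrow> ennreal" where
  "sugeno z = (SUP t. min t (emeasure counting {i \<in> {1..}. t \<le> z i}))"

definition upper_sugeno2 :: "(nat \<Rightarrow> ennreal) \<Rightarrow> ennreal" where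
  "upper_sugeno2 z = (SUP t. min (t + sugeno z) (emeasure counting {i \<in> {1..}. t \<le> z i}))"

definition lower_sugeno2 :: "(nat \<Rightarrow> ennreal) \<Rightarrow> ennreal" where
  "lower_sugeno2 z = (SUP t. min t (emeasure counting {i \<in> {1..}. t \<le> z i} + sugeno z))"

text \<open>
  The maxima above are taken over finite nonempty sets, and the alternative expressions for
  the indices agree with the chosen ones.
\<close>

lemma scientific_record_le:
  assumes "scientific_record x" "1 \<le> k"
  shows "x k \<le> x 1"
  using assms unfolding scientific_record_def by (auto simp: monotone_on_def)

lemma finite_h_index_set:
  assumes "scientific_record x"
  shows "finite {k \<in> {1..}. k \<le> x k}" "{k \<in> {1..}. k \<le> x k} \<noteq> {}"
proof -
  have "{k \<in> {1..}. k \<le> x k} \<subseteq> {..x 1}"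
    using scientific_record_le[OF assms] by fastforce
  then show "finite {k \<in> {1..}. k \<le> x k}"
    by (rule finite_subset) simp
  show "{k \<in> {1..}. k \<le> x k} \<noteq> {}"
    using assms by (auto simp: scientific_record_def)
qed

lemma finite_image_record:
  fixes f :: "nat \<Rightarrow> nat"
  assumes "scientific_record x" "\<And>k. 1 \<le> k \<Longrightarrow> f k \<le> x k + c"
  shows "finite (f ` {1..})"
proof -
  have "f ` {1..} \<subseteq> {..x 1 + c}"
    using scientific_record_le[OF assms(1)] assms(2) by (fastforce intro: order_trans)
  then show ?thesis
    by (rule finite_subset) simp
qed

lemma h_index_eq_Max_min:
  assumes "scientific_record x"
  shows "h_index x = Max ((\<lambda>k. min k (x k)) ` {1..})"
proof -
  let ?H = "h_index x"
  note fin = finite_h_index_set[OF assms]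
  have H: "1 \<le> ?H" "?H \<le> x ?H"
    using Max_in[OF fin] by (auto simp: h_index_def)
  have "min k (x k) \<le> ?H" if "1 \<le> k" for k
  proof (cases "min k (x k) = 0")
    case False
    define m where "m = min k (x k)"
    have m: "1 \<le> m" "m \<le> k" "m \<le> x k"
      using False by (auto simp: m_def)
    then have "x k \<le> x m"
      using assms by (auto simp: scientific_record_def monotone_on_def)
    with m show ?thesis
      unfolding h_index_def m_def[symmetric] by (intro Max_ge fin) auto
  qed simp
  moreover have "?H \<in> (\<lambda>k. min k (x k)) ` {1..}"
    using H by (intro image_eqI[of _ _ ?H]) auto
  ultimately show ?thesis
    using finite_image_record[OF assms, of "\<lambda>k. min k (x k)" 0]
    by (intro Max_eqI[symmetric]) auto
qed

lemma lower_h2_index_eq_Max_min: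
  assumes "scientific_record x"
  shows "lower_h2_index x = Max ((\<lambda>k. min k (x k + h_index x)) ` {1..})"
proof -
  let ?H = "h_index x" and ?f = "\<lambda>k. min (k - h_index x) (x k)"
  have H: "1 \<le> ?H"
    using Max_in[OF finite_h_index_set[OF assms]] by (auto simp: h_index_def)
  have fin: "finite (?f ` {1..})"
    by (rule finite_image_record[OF assms, where c = 0]) simp
  then have "Max (?f ` {1..}) \<in> ?f ` {1..}"
    by (intro Max_in) auto
  then obtain k where k: "1 \<le> k" "Max (?f ` {1..}) = ?f k"
    by auto
  have "lower_h2_index x \<in> (\<lambda>k. min k (x k + ?H)) ` {1..}"
  proof (cases "?H \<le> k")
    case True
    then show ?thesis
      using k by (intro image_eqI[of _ _ k]) (auto simp: lower_h2_index_def)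
  next
    case False
    then show ?thesis
      using k H by (intro image_eqI[of _ _ ?H]) (auto simp: lower_h2_index_def)
  qed
  moreover have "min j (x j + ?H) \<le> lower_h2_index x" if "1 \<le> j" for j
  proof -
    have "?f j \<le> Max (?f ` {1..})"
      using that fin by (intro Max_ge) auto
    then show ?thesis
      unfolding lower_h2_index_def by linarith
  qed
  ultimately show ?thesis
    using finite_image_record[OF assms, of "\<lambda>k. min k (x k + ?H)" ?H]
    by (intro Max_eqI[symmetric]) auto
qed

lemma finite_upper_h2_index_set:
  assumes "scientific_record x"
  shows "finite ((\<lambda>k. min (k + h_index x) (x k)) ` {1..})"
  by (rule finite_image_record[OF assms, where c = 0]) simp

end

theory Submission
  imports Defs
begin

text \<open>
  For a nonincreasing sequence \<open>z\<close>, the level function \<open>L t = \<mu> {i. t \<le> z i}\<close> is a generalised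
  inverse of \<open>z\<close>: \<open>n \<le> L t\<close> holds iff \<open>t \<le> z n\<close> (lemma \<open>le_level_iff\<close>). Moreover \<open>L\<close> takes only
  natural values and \<open>\<infinity>\<close>, so a supremum of \<open>min (t + a) (L t + b)\<close> over all \<open>t\<close> in \<open>[0,\<infinity>]\<close> is
  decided by the values of \<open>z\<close> at two consecutive integers: it equals \<open>N\<close> as soon as the target
  \<open>N\<close> is reached and \<open>N + 1\<close> is not (lemma \<open>SUP_min_level_eq\<close>). All Sugeno integrals in question
  are such suprema: \<open>a = b = 0\<close> gives the plain one, \<open>b = 0\<close> the upper and \<open>a = 0\<close> the lower one.

  The three indices of a record are determined by the same kind of two-point inequalities, and
  the conjugate \<open>y\<close> is the level function of \<open>x\<close> at integers, so that \<open>m \<le> y n\<close> iff \<open>n \<le> x m\<close>.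
  This equivalence turns the inequalities for \<open>x\<close> into those for \<open>y\<close> with \<open>a\<close> and \<open>b\<close> exchanged,
  which is why conjugation swaps the upper and the lower integral.
\<close>

section \<open>Level functions of nonincreasing sequences\<close>

abbreviation level :: "(nat \<Rightarrow> ennreal) \<Rightarrow> ennreal \<Rightarrow> ennreal" where
  "level z t \<equiv> emeasure counting {i \<in> {1..}. t \<le> z i}"

text \<open>
  By monotonicity \<open>{i. t \<le> z i}\<close> is an initial segment of the positive integers, so it has at
  least \<open>n\<close> elements exactly when it contains \<open>n\<close>.
\<close>

lemma le_level_iff:
  assumes "antimono_on {1..} z" "1 \<le> n"
  shows "of_nat n \<le> level z t \<longleftrightarrow> t \<le> z n"
proof
  assume t: "t \<le> z n"
  have "z n \<le> z i" if "i \<in> {1..n}" for i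
    using monotone_onD[OF assms(1), of i n] that by auto
  with t have sub: "{1..n} \<subseteq> {i \<in> {1..}. t \<le> z i}"
    by (auto intro: order_trans)
  have "of_nat n = emeasure counting {1..n}"
    by (subst emeasure_count_space_finite) auto
  also have "\<dots> \<le> level z t"
    using sub by (rule emeasure_mono) auto
  finally show "of_nat n \<le> level z t" .
next
  assume n: "of_nat n \<le> level z t"
  show "t \<le> z n"
  proof (rule ccontr)
    assume t: "\<not> t \<le> z n"
    have "i < n" if "1 \<le> i" "t \<le> z i" for i
    proof (rule ccontr)
      assume "\<not> i < n"
      then have "z i \<le> z n"
        using monotone_onD[OF assms(1), of n i] assms(2) by auto
      with that t show False by (meson order_trans)
    qed
    then have "{i \<in> {1..}. t \<le> z i} \<subseteq> {1..<n}"
      by auto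
    then have "level z t \<le> emeasure counting {1..<n}"
      by (rule emeasure_mono) auto
    also have "\<dots> = of_nat (n - 1)"
      by (subst emeasure_count_space_finite) auto
    finally have "(of_nat n :: ennreal) \<le> of_nat (n - 1)"
      using n by (rule order_trans[rotated])
    then show False
      using assms(2) by (simp only: of_nat_le_iff)
  qed
qed

lemma emeasure_counting_le_of_nat_iff:
  assumes "A \<subseteq> {1..}"
  shows "emeasure counting A \<le> of_nat n \<longleftrightarrow> \<not> of_nat (Suc n) \<le> emeasure counting A"
proof (cases "finite A")
  case True
  then have "emeasure counting A = of_nat (card A)"
    using assms by (rule emeasure_count_space_finite[rotated])
  then show ?thesis
    by (simp only: of_nat_le_iff) auto
next
  case False
  then have "emeasure counting A = \<infinity>"
    using assms by (rule emeasure_count_space_infinite[rotated])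
  then show ?thesis by (simp add: top_unique)
qed

text \<open>
  For the upper bound, a point \<open>t\<close> with \<open>L t + b > N\<close> has \<open>L t \<ge> N + 1 - b\<close> by integrality, hence
  \<open>t \<le> z (N + 1 - b)\<close>. The value \<open>N\<close> is attained at \<open>t = z (N - b)\<close>, except that the index \<open>0\<close>
  arising for \<open>b = N\<close> is not one of the sequence; then the second term alone is at least \<open>N\<close>, and
  \<open>t = \<infinity>\<close> will do.
\<close>

lemma SUP_min_level_eq:
  fixes z :: "nat \<Rightarrow> ennreal" and a b N :: nat
  assumes z: "antimono_on {1..} z"
    and b: "b \<le> N"
    and reached: "b < N \<Longrightarrow> of_nat N \<le> z (N - b) + of_nat a"
    and exceeded: "z (N + 1 - b) + of_nat a \<le> of_nat N"
  shows "(SUP t. min (t + of_nat a) (level z t + of_nat b)) = of_nat N"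
proof (rule antisym)
  have bN: "of_nat (N - b) + of_nat b = (of_nat N :: ennreal)"
    using b by (simp flip: of_nat_add)
  show "(SUP t. min (t + of_nat a) (level z t + of_nat b)) \<le> of_nat N"
  proof (rule SUP_least)
    fix t :: ennreal
    show "min (t + of_nat a) (level z t + of_nat b) \<le> of_nat N"
    proof (cases "level z t \<le> of_nat (N - b)")
      case True
      then have "level z t + of_nat b \<le> of_nat (N - b) + of_nat b"
        by (rule add_right_mono)
      then show ?thesis
        by (simp only: bN min.coboundedI2)
    next
      case False
      then have "of_nat (Suc (N - b)) \<le> level z t"
        using emeasure_counting_le_of_nat_iff[of "{i \<in> {1..}. t \<le> z i}" "N - b"] by auto
      then have "t \<le> z (N + 1 - b)"
        using le_level_iff[OF z, of "Suc (N - b)" t] b by (simp add: Suc_diff_le)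
      then have "t + of_nat a \<le> of_nat N"
        by (rule order_trans[OF add_right_mono exceeded])
      then show ?thesis by (rule min.coboundedI1)
    qed
  qed
  show "of_nat N \<le> (SUP t. min (t + of_nat a) (level z t + of_nat b))"
  proof (cases "b = N")
    case True
    show ?thesis
      by (rule SUP_upper2[of top]) (auto simp: True)
  next
    case False
    then have "b < N" using b by simp
    have "of_nat (N - b) \<le> level z (z (N - b))"
      using \<open>b < N\<close> by (subst le_level_iff[OF z]) auto
    then have "of_nat N \<le> level z (z (N - b)) + of_nat b"
      by (subst bN[symmetric]) (rule add_right_mono)
    then show ?thesis
      using reached[OF \<open>b < N\<close>] by (intro SUP_upper2[of "z (N - b)"]) auto
  qed
qed

lemma sugeno_eq:
  assumes "antimono_on {1..} z" "1 \<le> N" "of_nat N \<le> z N" "z (N + 1) \<le> of_nat N"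
  shows "sugeno z = of_nat N"
  using SUP_min_level_eq[of z 0 N 0] assms by (simp add: sugeno_def)

lemma upper_sugeno2_eq:
  assumes "antimono_on {1..} z" "sugeno z = of_nat H" "1 \<le> N"
    "of_nat N \<le> z N + of_nat H" "z (N + 1) + of_nat H \<le> of_nat N"
  shows "upper_sugeno2 z = of_nat N"
  using SUP_min_level_eq[of z 0 N H] assms by (simp add: upper_sugeno2_def)

lemma lower_sugeno2_eq:
  assumes "antimono_on {1..} z" "sugeno z = of_nat H" "H \<le> N"
    "H < N \<Longrightarrow> of_nat N \<le> z (N - H)" "z (N + 1 - H) \<le> of_nat N"
  shows "lower_sugeno2 z = of_nat N"
  using SUP_min_level_eq[of z H N 0] assms by (simp add: lower_sugeno2_def)

section \<open>Records and their conjugates\<close>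

lemma antimono_on_of_nat_record:
  assumes "scientific_record x"
  shows "antimono_on {1..} (\<lambda>i. of_nat (x i) :: ennreal)"
  using assms by (auto simp: scientific_record_def monotone_on_def)

lemma conjugate_eq_level: "conjugate x n = level (\<lambda>i. of_nat (x i)) (of_nat n)"
  by (simp add: conjugate_def)

lemma antimono_on_conjugate: "antimono_on {1..} (conjugate x)"
  unfolding conjugate_def by (intro monotone_onI emeasure_mono) auto

lemma le_conjugate_iff:
  assumes "scientific_record x" "1 \<le> m"
  shows "of_nat m \<le> conjugate x n \<longleftrightarrow> n \<le> x m"
  using le_level_iff[OF antimono_on_of_nat_record[OF assms(1)] assms(2), of "of_nat n"]
  by (simp add: conjugate_eq_level)

lemma conjugate_le_iff:
  assumes "scientific_record x"
  shows "conjugate x n \<le> of_nat m \<longleftrightarrow> x (m + 1) < n"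
  using emeasure_counting_le_of_nat_iff[of "{k \<in> {1..}. n \<le> x k}" m]
    le_conjugate_iff[OF assms, of "m + 1" n]
  by (auto simp: conjugate_def)

section \<open>Two-point inequalities for the indices\<close>

lemma h_index_bounds:
  assumes "scientific_record x"
  shows "1 \<le> h_index x" "h_index x \<le> x (h_index x)" "x (h_index x + 1) \<le> h_index x"
proof -
  note fin = finite_h_index_set[OF assms]
  show "1 \<le> h_index x" "h_index x \<le> x (h_index x)"
    using Max_in[OF fin] by (auto simp: h_index_def)
  show "x (h_index x + 1) \<le> h_index x"
  proof (rule ccontr)
    assume "\<not> x (h_index x + 1) \<le> h_index x"
    then have "h_index x + 1 \<in> {k \<in> {1..}. k \<le> x k}"
      by simp
    from Max_ge[OF fin(1) this] have "h_index x + 1 \<le> h_index x"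
      by (simp only: h_index_def)
    then show False by simp
  qed
qed

text \<open>
  In the maximum of \<open>min k (x k + H)\<close> the first entry increases and the second decreases with \<open>k\<close>.
  So if some \<open>k\<close> brings both up to \<open>N\<close>, the least \<open>k\<close> allowed by the first entry, \<open>k = N\<close>, does
  so too. For the upper index the same reasoning singles out \<open>k = N - H\<close>.
\<close>

lemma lower_h2_index_bounds:
  assumes "scientific_record x"
  defines "H \<equiv> h_index x" and "N \<equiv> lower_h2_index x"
  shows "H \<le> N" "N \<le> x N + H" "x (N + 1) + H \<le> N"
proof -
  let ?A = "(\<lambda>k. min k (x k + H)) ` {1..}"
  have N: "N = Max ?A"
    unfolding N_def H_def by (rule lower_h2_index_eq_Max_min[OF assms(1)])
  have fin: "finite ?A"
    by (rule finite_image_record[OF assms(1), where c = H]) simp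
  show "H \<le> N"
    by (simp add: H_def N_def lower_h2_index_def)
  have "1 \<le> H"
    unfolding H_def by (rule h_index_bounds[OF assms(1)])
  have "N \<in> ?A"
    unfolding N using fin by (intro Max_in) auto
  then obtain k where k: "1 \<le> k" "N = min k (x k + H)"
    by auto
  then have "x k \<le> x N"
    using assms(1) \<open>1 \<le> H\<close> \<open>H \<le> N\<close>
    by (intro monotone_onD[of "{1..}" "(\<le>)" "(\<ge>)" x]) (auto simp: scientific_record_def)
  with k show "N \<le> x N + H" by linarith
  have "min (N + 1) (x (N + 1) + H) \<le> N"
    using fin by (subst (3) N) (intro Max_ge imageI, auto)
  then show "x (N + 1) + H \<le> N" by linarith
qed

lemma upper_h2_index_bounds:
  assumes "scientific_record x"
  defines "H \<equiv> h_index x" and "N \<equiv> upper_h2_index x"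
  shows "H \<le> N" "H < N \<Longrightarrow> N \<le> x (N - H)" "x (N + 1 - H) \<le> N"
proof -
  let ?A = "(\<lambda>k. min (k + H) (x k)) ` {1..}"
  have fin: "finite ?A"
    unfolding H_def by (rule finite_upper_h2_index_set[OF assms(1)])
  have N_ge: "min (k + H) (x k) \<le> N" if "1 \<le> k" for k
    unfolding N_def upper_h2_index_def H_def[symmetric] using fin that
    by (intro Max_ge imageI) auto
  show "H \<le> N"
    using N_ge[of H] h_index_bounds[OF assms(1)] by (simp add: H_def)
  have "N \<in> ?A"
    unfolding N_def upper_h2_index_def H_def[symmetric] using fin by (intro Max_in) auto
  then obtain k where k: "1 \<le> k" "N = min (k + H) (x k)"
    by auto
  show "N \<le> x (N - H)" if "H < N"
  proof -
    have "x k \<le> x (N - H)"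
      using assms(1) k that
      by (intro monotone_onD[of "{1..}" "(\<le>)" "(\<ge>)" x]) (auto simp: scientific_record_def)
    with k show ?thesis by linarith
  qed
  show "x (N + 1 - H) \<le> N"
    using N_ge[of "N + 1 - H"] \<open>H \<le> N\<close> by linarith
qed

section \<open>The Sugeno integrals of a record and of its conjugate\<close>

lemma sugeno_record:
  assumes "scientific_record x"
  shows "sugeno (\<lambda>i. of_nat (x i)) = of_nat (h_index x)"
  using h_index_bounds[OF assms]
  by (intro sugeno_eq antimono_on_of_nat_record assms) simp_all

lemma sugeno_conjugate:
  assumes "scientific_record x"
  shows "sugeno (conjugate x) = of_nat (h_index x)"
  using h_index_bounds[OF assms]
  by (intro sugeno_eq antimono_on_conjugate)
    (simp_all add: le_conjugate_iff[OF assms] conjugate_le_iff[OF assms])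

theorem proposition5p4:
  fixes x :: "nat \<Rightarrow> nat"
  assumes "scientific_record x"
  shows "upper_sugeno2 (\<lambda>i. of_nat (x i)) = of_nat (lower_h2_index x)
       \<and> of_nat (lower_h2_index x) = lower_sugeno2 (conjugate x)
       \<and> lower_sugeno2 (\<lambda>i. of_nat (x i)) = of_nat (upper_h2_index x)
       \<and> of_nat (upper_h2_index x) = upper_sugeno2 (conjugate x)"
proof -
  let ?H = "h_index x" and ?L = "lower_h2_index x" and ?U = "upper_h2_index x"
  note x = antimono_on_of_nat_record[OF assms] sugeno_record[OF assms]
  note y = antimono_on_conjugate sugeno_conjugate[OF assms]
  note H = h_index_bounds(1)[OF assms]
  note L = lower_h2_index_bounds[OF assms]
  note U = upper_h2_index_bounds[OF assms]
  have "upper_sugeno2 (\<lambda>i. of_nat (x i)) = of_nat ?L"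
    using H L by (intro upper_sugeno2_eq[OF x]) (simp_all flip: of_nat_add)
  moreover have "lower_sugeno2 (conjugate x) = of_nat ?L"
  proof (rule lower_sugeno2_eq[OF y L(1)])
    show "of_nat ?L \<le> conjugate x (?L - ?H)" if "?H < ?L"
      using L that by (subst le_conjugate_iff[OF assms]) linarith+
    show "conjugate x (?L + 1 - ?H) \<le> of_nat ?L"
      using L by (subst conjugate_le_iff[OF assms]) linarith
  qed
  moreover have "lower_sugeno2 (\<lambda>i. of_nat (x i)) = of_nat ?U"
    using U by (intro lower_sugeno2_eq[OF x]) simp_all
  moreover have "upper_sugeno2 (conjugate x) = of_nat ?U"
  proof (rule upper_sugeno2_eq[OF y])
    have shift: "of_nat ?U = of_nat (?U - ?H) + (of_nat ?H :: ennreal)"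
      using U(1) by (simp flip: of_nat_add)
    show "1 \<le> ?U" using H U(1) by linarith
    show "of_nat ?U \<le> conjugate x ?U + of_nat ?H"
    proof (cases "?H < ?U")
      case True
      then have "of_nat (?U - ?H) \<le> conjugate x ?U"
        using U by (subst le_conjugate_iff[OF assms]) simp_all
      then show ?thesis
        by (subst shift) (rule add_right_mono)
    next
      case False
      then have "?U = ?H" using U(1) by simp
      then show ?thesis by simp
    qed
    have "conjugate x (?U + 1) \<le> of_nat (?U - ?H)"
      using U(1,3) by (subst conjugate_le_iff[OF assms]) (simp add: Suc_diff_le)
    then show "conjugate x (?U + 1) + of_nat ?H \<le> of_nat ?U"
      by (subst shift) (rule add_right_mono)
  qed
  ultimately show ?thesis by simp
qed

end
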